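(* Let $n\ge1$ be an integer, let $X_1,\ldots,X_n$ be independent Bernoulli random variables with $\Pr(X_i=1)=1-\Pr(X_i=0)=p_i$, $0<p_i<1$, and let $f^S$ be the probability mass function of $S=\sum_{i=1}^n X_i$. Let $\lambda=\sum_{i=1}^n p_i$ and $\bar p=\lambda/n$. Suppose that $m',m$ are integers with $m'\geq m\geq n$ and that $p'\in(0,1)$. Then $$D(f^S|\mathrm{bi}(m', p'))\geq D\bigl(f^S|\mathrm{bi}(m, \lambda/m)\bigr)+D\bigl(\mathrm{bi}(m, \lambda/m)|\mathrm{bi}(m', p')\bigr)$$ and therefore $$D(f^S|\mathrm{bi}(m', p'))\geq D\bigl(f^S|\mathrm{bi}(m, \lambda/m)\bigr)\geq D(f^S|\mathrm{bi}(n, \bar p)).$$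
   Context: $\mathrm{bi}(m,p)$ denotes the binomial probability mass function with $m$ trials and success probability $p$, i.e. $\mathrm{bi}(m,p)_i=\binom{m}{i}p^i(1-p)^{m-i}$ for $0\le i\le m$ and $0$ for $i>m$. For probability mass functions $f,g$ on $\mathbf{Z}_+=\{0,1,2,\ldots\}$, with $\mathrm{supp}(f)=\{i:f_i>0\}$, the relative entropy is $D(f|g)=\sum_{i=0}^\infty f_i\log(f_i/g_i)$ if $\mathrm{supp}(f)\subset\mathrm{supp}(g)$, and $D(f|g)=\infty$ otherwise, with the convention $0\log(0/0)=0$. *)

theory Defs
  imports "HOL-Probability.Probability"
begin

definition supp :: "(nat \<Rightarrow> real) \<Rightarrow> nat set" where
  "supp f = {i. f i > 0}"

text \<open>
  Mass functions on the nonnegative integers are represented as real-valued functions.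
  The series is taken in the extended reals, so that it also has the intended value when it
  diverges to infinity.  Terms with \<^term>\<open>f i = 0\<close> vanish (including
  \<^term>\<open>f i = 0 \<and> g i = 0\<close>).  The logarithm is natural.
\<close>

definition rel_entropy :: "(nat \<Rightarrow> real) \<Rightarrow> (nat \<Rightarrow> real) \<Rightarrow> ereal" where
  "rel_entropy f g =
     (if supp f \<subseteq> supp g then (\<Sum>i. ereal (f i * ln (f i / g i))) else \<infinity>)"

abbreviation bi :: "nat \<Rightarrow> real \<Rightarrow> nat \<Rightarrow> real" where
  "bi m p \<equiv> pmf (binomial_pmf m p)"

end

theory Submission
  imports Defs
begin

text \<open>
  The statement is a Pythagorean inequality for relative entropy, and it reduces to a comparison of
  two expectations.  Write \<open>f\<close> for the law of \<open>S\<close>, \<open>b = bi(m, \<lambda>/m)\<close> and \<open>b' = bi(m', p')\<close>.  Since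
  \<open>D(f|b') - D(f|b) = \<Sum> f\<^sub>i h\<^sub>i\<close> and \<open>D(b|b') = \<Sum> b\<^sub>i h\<^sub>i\<close> with \<open>h\<^sub>i = ln (b\<^sub>i / b'\<^sub>i)\<close>, the
  first inequality says that the expectation of \<open>h\<close> is at least as large under \<open>f\<close> as under \<open>b\<close>.

  Two facts give this.  The function \<open>h\<close> is concave on \<open>{0..m}\<close>, because up to an additive constant
  its increments are \<open>ln ((m - i) / (m' - i))\<close>, which is nonincreasing in \<open>i\<close> when \<open>m \<le> m'\<close>
  (\<open>ln_bi_ratio_concave\<close>).  And by Hoeffding's comparison theorem the binomial law is
  the most spread out, in the convex order, among the laws of sums of \<open>m\<close> independent Bernoulli
  variables of a given total mean (\<open>bern_expect_concave_ge_binomial\<close>); the \<open>n\<close> given variables become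
  \<open>m\<close> variables by adding \<open>m - n\<close> variables that vanish.

  Hoeffding's theorem is proved by induction on the number of variables.  If \<open>c\<close> is the average of
  the success probabilities, there are two of them with \<open>a \<le> c \<le> b\<close>.  Replacing \<open>a, b\<close> by
  \<open>c, a + b - c\<close> keeps the sum and does not decrease the product, and this cannot raise the
  expectation of a concave function, since the product enters with the second difference as its
  coefficient (\<open>bern_expect_move_together_le\<close>).  Conditioning on the variable with parameter \<open>c\<close> leaves a
  concave function of a sum of one variable fewer whose parameters still have average \<open>c\<close>.

  The second inequality then follows from \<open>D(b|b') \<ge> 0\<close>, and the third is the second with
  \<open>n\<close>, \<open>m\<close> and \<open>\<lambda>/m\<close> in place of \<open>m\<close>, \<open>m'\<close> and \<open>p'\<close>.
\<close>

section \<open>Sums of independent Bernoulli variables\<close>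

text \<open>
  The expectation of \<open>h(S)\<close>, for \<open>S\<close> a sum of independent Bernoulli variables with parameters
  \<open>ps\<close>, computed by conditioning on the variables one at a time.  A recursion over a list,
  in place of an integral, makes the induction on the number of variables and the
  modification of single parameters direct.
\<close>

fun bern_expect :: "real list \<Rightarrow> (nat \<Rightarrow> real) \<Rightarrow> real" where
  "bern_expect [] h = h 0"
| "bern_expect (p # ps) h = (1 - p) * bern_expect ps h + p * bern_expect ps (\<lambda>i. h (Suc i))"

definition poisson_binomial :: "real list \<Rightarrow> nat \<Rightarrow> real" where
  "poisson_binomial ps k = bern_expect ps (\<lambda>i. of_bool (i = k))"

lemma bern_expect_cong:
  "(\<And>i. i \<le> length ps \<Longrightarrow> h i = g i) \<Longrightarrow> bern_expect ps h = bern_expect ps g"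
proof (induction ps arbitrary: h g)
  case (Cons p ps)
  have "bern_expect ps h = bern_expect ps g"
      "bern_expect ps (\<lambda>i. h (Suc i)) = bern_expect ps (\<lambda>i. g (Suc i))"
    by (rule Cons.IH; simp add: Cons.prems)+
  then show ?case by simp
qed simp

lemma bern_expect_add: "bern_expect ps (\<lambda>i. h i + g i) = bern_expect ps h + bern_expect ps g"
  by (induction ps arbitrary: h g) (simp_all add: algebra_simps)

lemma bern_expect_cmult: "bern_expect ps (\<lambda>i. a * h i) = a * bern_expect ps h"
  by (induction ps arbitrary: h) (simp_all add: algebra_simps)

lemma bern_expect_sum:
  assumes "finite A"
  shows "bern_expect ps (\<lambda>i. \<Sum>j\<in>A. h j i) = (\<Sum>j\<in>A. bern_expect ps (h j))"
  using assms
proof (induction A rule: finite_induct)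
  case empty
  show ?case using bern_expect_cmult[of ps 0 "\<lambda>_. 0"] by simp
qed (simp add: bern_expect_add)

lemma bern_expect_nonneg:
  assumes "set ps \<subseteq> {0..1}" and "\<And>i. i \<le> length ps \<Longrightarrow> 0 \<le> h i"
  shows "0 \<le> bern_expect ps h"
  using assms
proof (induction ps arbitrary: h)
  case (Cons p ps)
  have "0 \<le> bern_expect ps h" "0 \<le> bern_expect ps (\<lambda>i. h (Suc i))"
    using Cons by auto
  then show ?case using Cons.prems(1) by simp
qed simp

text \<open>
  The choice of \<open>m\<close> above the length allows laws with different numbers of summands to be
  compared on a common range of summation.
\<close>

lemma bern_expect_eq_sum_poisson_binomial:
  assumes "length ps \<le> m"
  shows "bern_expect ps h = (\<Sum>k\<le>m. poisson_binomial ps k * h k)"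
proof -
  have "bern_expect ps h = bern_expect ps (\<lambda>i. \<Sum>k\<le>m. h k * of_bool (i = k))"
    using assms
    by (intro bern_expect_cong) (simp add: of_bool_def if_distrib[of "(*) _"] cong: if_cong)
  also have "\<dots> = (\<Sum>k\<le>m. poisson_binomial ps k * h k)"
    by (simp only: bern_expect_sum finite_atMost bern_expect_cmult poisson_binomial_def mult.commute)
  finally show ?thesis .
qed

lemma poisson_binomial_eq_0:
  assumes "length ps < k"
  shows "poisson_binomial ps k = 0"
proof -
  have "poisson_binomial ps k = bern_expect ps (\<lambda>i. 0 * 0)"
    unfolding poisson_binomial_def using assms by (intro bern_expect_cong) auto
  then show ?thesis by (simp only: bern_expect_cmult)
qed

text \<open>
  The expectation is symmetric in the parameters; this form brings any chosen parameter to the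
  head of the list, where the recursion acts.
\<close>

lemma bern_expect_move_to_front: "bern_expect (xs @ a # ys) h = bern_expect (a # xs @ ys) h"
proof (induction xs arbitrary: h)
  case (Cons x xs)
  have "bern_expect ((x # xs) @ a # ys) h
      = (1 - x) * bern_expect (a # xs @ ys) h + x * bern_expect (a # xs @ ys) (\<lambda>i. h (Suc i))"
    by (simp only: append_Cons bern_expect.simps(2) Cons.IH)
  then show ?case by (simp add: algebra_simps)
qed simp

lemma bern_expect_zeros: "bern_expect (replicate k 0 @ ps) h = bern_expect ps h"
  by (induction k arbitrary: h) simp_all

lemma poisson_binomial_Cons:
  "poisson_binomial (p # ps) k = (1 - p) * poisson_binomial ps k
    + p * (if k = 0 then 0 else poisson_binomial ps (k - 1))"
proof (cases k)
  case 0
  then show ?thesis using bern_expect_cmult[of ps 0 "\<lambda>_. 0"] by (simp add: poisson_binomial_def)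
qed (simp add: poisson_binomial_def)

lemma poisson_binomial_replicate:
  assumes "0 \<le> c" "c \<le> 1"
  shows "poisson_binomial (replicate m c) k = bi m c k"
proof (induction m arbitrary: k)
  case 0
  then show ?case using assms by (simp add: poisson_binomial_def pmf_binomial)
next
  case (Suc m)
  show ?case
  proof (cases k)
    case 0
    then show ?thesis using assms by (simp add: poisson_binomial_Cons Suc pmf_binomial)
  next
    case (Suc j)
    \<comment> \<open>For \<open>j \<ge> m\<close> the exponents are truncated, but the binomial coefficient vanishes.\<close>
    have "m - j = Suc (m - Suc j) \<or> m choose Suc j = 0"
      by (cases "j < m") auto
    then show ?thesis
      using assms Suc.IH Suc by (auto simp: poisson_binomial_Cons Suc.IH pmf_binomial algebra_simps)
  qed
qed

section \<open>Hoeffding's comparison with the binomial law\<close>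

lemma ex_le_average:
  fixes xs :: "real list"
  assumes "sum_list xs \<le> real (length xs) * c" "xs \<noteq> []"
  shows "\<exists>x\<in>set xs. x \<le> c"
proof (rule ccontr)
  assume "\<not> ?thesis"
  then have *: "sum_list xs > sum_list (map (\<lambda>_. c) xs)"
    using assms(2) sum_list_strict_mono[of xs "\<lambda>_. c" "\<lambda>x. x"] by (simp add: not_le)
  then show False using assms(1) by (simp add: map_replicate_const sum_list_replicate)
qed

lemma ex_ge_average:
  fixes xs :: "real list"
  assumes "real (length xs) * c \<le> sum_list xs" "xs \<noteq> []"
  shows "\<exists>x\<in>set xs. c \<le> x"
proof (rule ccontr)
  assume "\<not> ?thesis"
  then have *: "sum_list xs < sum_list (map (\<lambda>_. c) xs)"
    using assms(2) sum_list_strict_mono[of xs "\<lambda>x. x" "\<lambda>_. c"] by (simp add: not_le)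
  then show False using assms(1) by (simp add: map_replicate_const sum_list_replicate)
qed

text \<open>
  As a function of the first two parameters \<open>x, y\<close>, the expectation is affine in \<open>x + y\<close> plus \<open>x y\<close>
  times the expected second difference of \<open>h\<close>, which is nonpositive.  The replacement
  fixes \<open>x + y\<close> and increases \<open>x y\<close> by \<open>(c - a) (b - c)\<close>.
\<close>

lemma bern_expect_move_together_le:
  assumes "set ps \<subseteq> {0..1}" and "a \<le> c" "c \<le> b"
    and "\<And>i. i \<le> length ps \<Longrightarrow> h i + h (i + 2) \<le> 2 * h (i + 1)"
  shows "bern_expect (c # (a + b - c) # ps) h \<le> bern_expect (a # b # ps) h"
proof -
  let ?D = "bern_expect ps (\<lambda>i. 2 * h (Suc i) + (-1) * (h i + h (Suc (Suc i))))"
  have D: "?D = 2 * bern_expect ps (\<lambda>i. h (Suc i))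
      - (bern_expect ps h + bern_expect ps (\<lambda>i. h (Suc (Suc i))))"
    by (simp only: bern_expect_add bern_expect_cmult) simp
  have "0 \<le> ?D"
  proof (rule bern_expect_nonneg[OF assms(1)])
    show "0 \<le> 2 * h (Suc i) + (-1) * (h i + h (Suc (Suc i)))" if "i \<le> length ps" for i
      using assms(4)[OF that] by simp
  qed
  then have "0 \<le> (c - a) * (b - c) * ?D"
    using assms by simp
  also have "\<dots> = bern_expect (a # b # ps) h - bern_expect (c # (a + b - c) # ps) h"
    unfolding D by (simp add: algebra_simps)
  finally show ?thesis by simp
qed

text \<open>
  Each step makes one parameter equal to the average \<open>c\<close> and then absorbs that variable into
  the function, replacing \<open>h\<close> by \<open>(1 - c) h\<^sub>i + c h\<^sub>i\<^sub>+\<^sub>1\<close>.  This mixture is again concave and the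
  remaining parameters again average to \<open>c\<close>, so the induction needs no limiting argument.
\<close>

lemma bern_expect_concave_ge_binomial:
  assumes "set ps \<subseteq> {0..1}" and "sum_list ps = real (length ps) * c"
    and "\<And>i. i + 2 \<le> length ps \<Longrightarrow> h i + h (i + 2) \<le> 2 * h (i + 1)"
  shows "bern_expect (replicate (length ps) c) h \<le> bern_expect ps h"
  using assms
proof (induction "length ps" arbitrary: ps h)
  case 0
  then show ?case by simp
next
  case (Suc m ps h)
  show ?case
  proof (cases m)
    case 0
    then obtain a where "ps = [a]"
      using Suc.hyps(2) by (metis length_0_conv length_Suc_conv)
    then show ?thesis using Suc.prems(2) by simp
  next
    case (Suc k)
    have "ps \<noteq> []" using Suc.hyps(2) by auto
    then obtain a where "a \<in> set ps" and ac: "a \<le> c"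
      using ex_le_average[of ps c] Suc.prems(2) by auto
    then obtain xs ys where ps1: "ps = xs @ a # ys" by (meson split_list)
    define qs where "qs = xs @ ys"
    have qs: "set qs \<subseteq> {0..1}" "a \<in> {0..1}" "length qs = m"
        "a + sum_list qs = real (Suc m) * c"
      using Suc.prems Suc.hyps(2) by (auto simp: qs_def ps1 algebra_simps)
    have "qs \<noteq> []" using qs(3) Suc by auto
    moreover have "real (length qs) * c \<le> sum_list qs" using qs(3,4) ac by (simp add: algebra_simps)
    ultimately obtain b where "b \<in> set qs" and cb: "c \<le> b"
      using ex_ge_average by blast
    then obtain us vs where qs1: "qs = us @ b # vs" by (meson split_list)
    define rs where "rs = us @ vs"
    have rs: "set rs \<subseteq> {0..1}" "b \<in> {0..1}" "length rs = k"
        "a + b + sum_list rs = real (Suc m) * c"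
      using qs Suc by (auto simp: rs_def qs1 algebra_simps)
    let ?qs = "(a + b - c) # rs"
    let ?g = "\<lambda>i. (1 - c) * h i + c * h (Suc i)"
    have c01: "0 \<le> c" "c \<le> 1" using ac cb qs(2) rs(2) by auto
    have "bern_expect (replicate (Suc m) c) h = bern_expect (replicate (length ?qs) c) ?g"
      using rs(3) Suc by (simp add: bern_expect_add bern_expect_cmult)
    also have "\<dots> \<le> bern_expect ?qs ?g"
    proof (rule Suc.hyps(1))
      show "m = length ?qs" using rs(3) Suc by simp
      show "set ?qs \<subseteq> {0..1}" using rs(1,2) qs(2) ac cb by auto
      show "sum_list ?qs = real (length ?qs) * c"
        using rs(3,4) Suc by (simp add: algebra_simps)
      fix i assume "i + 2 \<le> length ?qs"
      then have "h i + h (i + 2) \<le> 2 * h (i + 1)" "h (i + 1) + h (i + 3) \<le> 2 * h (i + 2)"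
        using Suc.prems(3)[of i] Suc.prems(3)[of "i + 1"] rs(3) Suc.hyps(2) Suc
        by (simp_all add: numeral_3_eq_3)
      then have "(1 - c) * (h i + h (i + 2)) + c * (h (i + 1) + h (i + 3))
          \<le> (1 - c) * (2 * h (i + 1)) + c * (2 * h (i + 2))"
        using c01 by (intro add_mono mult_left_mono) auto
      then show "?g i + ?g (i + 2) \<le> 2 * ?g (i + 1)"
        by (simp add: algebra_simps numeral_3_eq_3)
    qed
    also have "\<dots> = bern_expect (c # ?qs) h"
      by (simp only: bern_expect_add bern_expect_cmult bern_expect.simps)
    also have "\<dots> \<le> bern_expect (a # b # rs) h"
      using rs Suc Suc.prems(3) Suc.hyps(2) ac cb by (intro bern_expect_move_together_le) auto
    also have "\<dots> = bern_expect ps h"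
      by (simp only: ps1 bern_expect_move_to_front bern_expect.simps qs_def[symmetric] qs1 rs_def)
    finally show ?thesis using Suc.hyps(2) by simp
  qed
qed


section \<open>The law of a sum of independent Bernoulli random variables\<close>

text \<open>
  Conditioning on the last variable gives the recursion of \<^const>\<open>poisson_binomial\<close>; the parameters
  are listed in reverse so that the last variable is the head of the list.
\<close>

lemma (in prob_space) prob_sum_bernoulli_eq_poisson_binomial:
  fixes X :: "nat \<Rightarrow> 'a \<Rightarrow> nat"
  assumes "indep_vars (\<lambda>_. count_space UNIV) X {1..n}"
    and "\<And>i. i \<in> {1..n} \<Longrightarrow> \<P>(\<omega> in M. X i \<omega> = 1) = p i"
    and "\<And>i. i \<in> {1..n} \<Longrightarrow> \<P>(\<omega> in M. X i \<omega> = 0) = 1 - p i"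
  shows "\<P>(\<omega> in M. (\<Sum>i=1..n. X i \<omega>) = k) = poisson_binomial (map p (rev [1..<Suc n])) k"
  using assms
proof (induction n arbitrary: k)
  case 0
  show ?case by (simp add: poisson_binomial_def prob_space)
next
  case (Suc n)
  let ?Y = "X (Suc n)" and ?S = "\<lambda>\<omega>. \<Sum>i\<in>{1..n}. X i \<omega>" and ?C = "count_space UNIV"
  let ?ps = "map p (rev [1..<Suc n])"
  have set_Suc: "{1..Suc n} = insert (Suc n) {1..n}" by auto
  have sum_Suc: "(\<Sum>i=1..Suc n. X i \<omega>) = ?Y \<omega> + ?S \<omega>" for \<omega>
    by (simp add: set_Suc)
  have IH: "\<P>(\<omega> in M. ?S \<omega> = k) = poisson_binomial ?ps k" for k
  proof (rule Suc.IH)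
    show "indep_vars (\<lambda>_. ?C) X {1..n}"
      by (rule indep_vars_subset[OF Suc.prems(1)]) auto
  qed (use Suc.prems(2,3) in auto)
  have rv: "X i \<in> measurable M ?C" if "i \<in> {1..Suc n}" for i
    using Suc.prems(1) that by (auto simp: indep_vars_def)
  have [measurable]: "?Y \<in> measurable M ?C" "?S \<in> measurable M ?C"
    using rv by auto
  have "indep_var
      ?C ((\<lambda>f. f (Suc n)) \<circ> (\<lambda>\<omega>. restrict (\<lambda>i. X i \<omega>) {Suc n}))
      ?C ((\<lambda>f. \<Sum>i\<in>{1..n}. f i) \<circ> (\<lambda>\<omega>. restrict (\<lambda>i. X i \<omega>) {1..n}))"
    using Suc.prems(1) unfolding set_Suc
    by (intro indep_var_compose[OF indep_var_restrict]) auto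
  then have indep: "indep_var ?C ?Y ?C ?S"
    by (simp add: comp_def)
  have joint: "\<P>(\<omega> in M. ?Y \<omega> = a \<and> ?S \<omega> = b) = \<P>(\<omega> in M. ?Y \<omega> = a) * \<P>(\<omega> in M. ?S \<omega> = b)" for a b
    using prob_indep_random_variable[OF indep, of "{a}" "{b}"] by simp
  have Y: "\<P>(\<omega> in M. ?Y \<omega> = 1) = p (Suc n)" "\<P>(\<omega> in M. ?Y \<omega> = 0) = 1 - p (Suc n)"
    using Suc.prems(2,3) by auto
  have "prob {\<omega> \<in> space M. ?Y \<omega> = 0 \<or> ?Y \<omega> = 1}
      = prob {\<omega> \<in> space M. ?Y \<omega> = 0} + prob {\<omega> \<in> space M. ?Y \<omega> = 1}"
    by (subst finite_measure_Union[symmetric]) (auto intro!: arg_cong[where f = prob])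
  then have "prob {\<omega> \<in> space M. ?Y \<omega> = 0 \<or> ?Y \<omega> = 1} = 1"
    using Y by simp
  \<comment> \<open>The variables are only assumed to take the values 0 and 1 with total probability one.\<close>
  then have AE01: "AE \<omega> in M. ?Y \<omega> = 0 \<or> ?Y \<omega> = 1"
    by (subst (asm) prob_Collect_eq_1) auto
  have "\<P>(\<omega> in M. (\<Sum>i=1..Suc n. X i \<omega>) = k)
      = prob ({\<omega> \<in> space M. ?Y \<omega> = 0 \<and> ?S \<omega> = k}
          \<union> {\<omega> \<in> space M. ?Y \<omega> = 1 \<and> Suc (?S \<omega>) = k})"
  proof (rule finite_measure_eq_AE)
    show "AE \<omega> in M. \<omega> \<in> {\<omega> \<in> space M. (\<Sum>i=1..Suc n. X i \<omega>) = k} \<longleftrightarrow>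
        \<omega> \<in> {\<omega> \<in> space M. ?Y \<omega> = 0 \<and> ?S \<omega> = k}
          \<union> {\<omega> \<in> space M. ?Y \<omega> = 1 \<and> Suc (?S \<omega>) = k}"
      using AE01 by eventually_elim (auto simp: sum_Suc)
    show "{\<omega> \<in> space M. (\<Sum>i=1..Suc n. X i \<omega>) = k} \<in> events"
      unfolding sum_Suc by measurable
  qed measurable
  also have "\<dots> = \<P>(\<omega> in M. ?Y \<omega> = 0 \<and> ?S \<omega> = k) + \<P>(\<omega> in M. ?Y \<omega> = 1 \<and> Suc (?S \<omega>) = k)"
  proof (rule finite_measure_Union)
    show "{\<omega> \<in> space M. ?Y \<omega> = 0 \<and> ?S \<omega> = k} \<in> events"
      and "{\<omega> \<in> space M. ?Y \<omega> = 1 \<and> Suc (?S \<omega>) = k} \<in> events"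
      by measurable
  qed auto
  also have "\<dots> = poisson_binomial (p (Suc n) # ?ps) k"
  proof -
    have zero: "\<P>(\<omega> in M. ?Y \<omega> = 0 \<and> ?S \<omega> = k) = (1 - p (Suc n)) * poisson_binomial ?ps k"
      by (simp only: joint IH Y)
    have one: "\<P>(\<omega> in M. ?Y \<omega> = 1 \<and> Suc (?S \<omega>) = Suc j) = p (Suc n) * poisson_binomial ?ps j" for j
      by (simp only: joint IH Y nat.inject)
    show ?thesis
      unfolding zero poisson_binomial_Cons add_left_cancel
      by (cases k) (simp_all only: one, simp_all)
  qed
  finally show ?case by simp
qed

section \<open>Relative entropy with respect to binomial laws\<close>

lemma rel_entropy_eq_sum:
  assumes "\<And>i. 0 \<le> f i" and "\<And>i. m < i \<Longrightarrow> f i = 0" and "\<And>i. i \<le> m \<Longrightarrow> 0 < g i"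
  shows "rel_entropy f g = ereal (\<Sum>i\<le>m. f i * ln (f i / g i))"
proof -
  have "supp f \<subseteq> supp g"
    using assms(2,3) unfolding supp_def by (metis (mono_tags) Collect_mono less_irrefl not_le)
  moreover have "(\<Sum>i. ereal (f i * ln (f i / g i))) = (\<Sum>i\<le>m. ereal (f i * ln (f i / g i)))"
    using assms(2) by (intro suminf_finite) (auto simp: zero_ereal_def)
  ultimately show ?thesis
    by (simp add: rel_entropy_def)
qed

lemma bi_pos:
  assumes "0 < c" "c < 1" "i \<le> m"
  shows "0 < bi m c i"
  using assms by (simp add: pmf_binomial)

lemma bi_eq_0:
  assumes "0 < c" "c < 1" "m < i"
  shows "bi m c i = 0"
  using assms by (simp add: pmf_binomial)

text \<open>
  The ratio of successive binomial weights: in the quotient of two binomial laws the factor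
  \<open>i + 1\<close> cancels, which leaves the dependence on \<open>i\<close> in \<open>(m - i) / (m' - i)\<close>.
\<close>

lemma bi_Suc:
  assumes "0 < c" "c < 1" "i < m"
  shows "bi m c (Suc i) = bi m c i * ((real m - real i) / real (Suc i) * (c / (1 - c)))"
proof -
  have "Suc i * (m choose Suc i) = (m - i) * (m choose i)"
    using binomial_absorption[of i m] binomial_absorb_comp[of m i] by simp
  then have "real (Suc i) * real (m choose Suc i) = (real m - real i) * real (m choose i)"
    using assms(3) by (metis of_nat_diff of_nat_mult less_imp_le)
  then have "real (m choose Suc i) = (real m - real i) / real (Suc i) * real (m choose i)"
    by (simp add: field_simps)
  moreover have "(1 - c) ^ (m - i) = (1 - c) * (1 - c) ^ (m - Suc i)"
    using assms(3) by (metis Suc_diff_Suc power_Suc)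
  ultimately show ?thesis
    using assms by (simp add: pmf_binomial)
qed

text \<open>
  The success probabilities enter the increments of \<open>h\<close> only through a constant, so concavity is
  the monotonicity of \<open>(m - i) / (m' - i) = 1 - (m' - m) / (m' - i)\<close>.
\<close>

lemma ln_bi_ratio_concave:
  assumes "0 < c" "c < 1" "0 < c'" "c' < 1" and "m \<le> m'" and "i + 2 \<le> m"
  defines "h \<equiv> \<lambda>i. ln (bi m c i / bi m' c' i)"
  shows "h i + h (i + 2) \<le> 2 * h (i + 1)"
proof -
  define K where "K = ln (c / (1 - c) / (c' / (1 - c')))"
  have step: "h (Suc j) = h j + ln ((real m - real j) / (real m' - real j)) + K" if "j < m" for j
  proof -
    have pos: "0 < bi m c j / bi m' c' j" "0 < (real m - real j) / (real m' - real j)"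
        "0 < c / (1 - c) / (c' / (1 - c'))"
      using that assms by (auto intro!: divide_pos_pos bi_pos)
    have "bi m c (Suc j) / bi m' c' (Suc j) = bi m c j / bi m' c' j
        * ((real m - real j) / (real m' - real j)) * (c / (1 - c) / (c' / (1 - c')))"
      using that assms by (simp add: bi_Suc mult_ac del: pmf_binomial)
    then show ?thesis
      unfolding h_def K_def by (simp only: ln_mult_pos pos mult_pos_pos)
  qed
  have "(real m - real (Suc i)) / (real m' - real (Suc i))
      \<le> (real m - real i) / (real m' - real i)"
    using assms(5,6) by (simp add: divide_simps) (simp add: algebra_simps)
  then have "ln ((real m - real (Suc i)) / (real m' - real (Suc i)))
      \<le> ln ((real m - real i) / (real m' - real i))"
    using assms(5,6) by (intro ln_mono) auto
  then show ?thesis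
    using step[of i] step[of "Suc i"] assms(6) by simp
qed

lemma poisson_binomial_nonneg: "set ps \<subseteq> {0..1} \<Longrightarrow> 0 \<le> poisson_binomial ps k"
  unfolding poisson_binomial_def by (rule bern_expect_nonneg) auto

text \<open>
  Hoeffding's comparison applied to the log-likelihood ratio of the two binomial laws.
\<close>

lemma rel_entropy_poisson_binomial_pythagoras:
  assumes "set ps \<subseteq> {0..1}" and "length ps \<le> m" and "sum_list ps = real m * c"
    and "0 < c" "c < 1" "0 < c'" "c' < 1" and "m \<le> m'"
  shows "rel_entropy (poisson_binomial ps) (bi m c) + rel_entropy (bi m c) (bi m' c')
    \<le> rel_entropy (poisson_binomial ps) (bi m' c')"
proof -
  let ?f = "poisson_binomial ps" and ?b = "bi m c" and ?b' = "bi m' c'"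
  let ?h = "\<lambda>i. ln (?b i / ?b' i)"
  \<comment> \<open>Zero parameters bring the number of summands to \<open>m\<close> without changing the law.\<close>
  let ?qs = "replicate (m - length ps) 0 @ ps"
  have len: "length ?qs = m" using assms(2) by simp
  have "bern_expect (replicate (length ?qs) c) ?h \<le> bern_expect ?qs ?h"
  proof (rule bern_expect_concave_ge_binomial)
    show "sum_list ?qs = real (length ?qs) * c"
      using assms(3) len by (simp add: sum_list_replicate)
    show "?h i + ?h (i + 2) \<le> 2 * ?h (i + 1)" if "i + 2 \<le> length ?qs" for i
      using assms that unfolding len by (intro ln_bi_ratio_concave) auto
  qed (use assms(1) in auto)
  then have "bern_expect (replicate m c) ?h \<le> bern_expect ps ?h"
    unfolding len bern_expect_zeros .
  then have hoeff: "(\<Sum>i\<le>m. ?b i * ?h i) \<le> (\<Sum>i\<le>m. ?f i * ?h i)"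
    using assms by (simp add: bern_expect_eq_sum_poisson_binomial[of _ m] poisson_binomial_replicate)
  have log_split: "?f i * ln (?f i / ?b' i) = ?f i * ln (?f i / ?b i) + ?f i * ?h i" if "i \<le> m" for i
  proof (cases "?f i = 0")
    case False
    have "0 < ?f i" using False poisson_binomial_nonneg[OF assms(1), of i] by simp
    moreover have "0 < ?b i" "0 < ?b' i" using that assms by (auto intro!: bi_pos)
    ultimately show ?thesis by (simp add: ln_div algebra_simps)
  qed simp
  have "(\<Sum>i\<le>m. ?f i * ln (?f i / ?b i)) + (\<Sum>i\<le>m. ?b i * ?h i)
      \<le> (\<Sum>i\<le>m. ?f i * ln (?f i / ?b' i))"
    using hoeff by (simp add: log_split sum.distrib)
  moreover have "rel_entropy ?f ?b = ereal (\<Sum>i\<le>m. ?f i * ln (?f i / ?b i))"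
    "rel_entropy ?f ?b' = ereal (\<Sum>i\<le>m. ?f i * ln (?f i / ?b' i))"
    "rel_entropy ?b ?b' = ereal (\<Sum>i\<le>m. ?b i * ?h i)"
    using assms by (intro rel_entropy_eq_sum;
        simp add: poisson_binomial_nonneg poisson_binomial_eq_0 bi_pos bi_eq_0 del: pmf_binomial)+
  ultimately show ?thesis by simp
qed

text \<open>
  Gibbs' inequality: \<open>ln x \<le> x - 1\<close> bounds each term below by \<open>b\<^sub>i - b'\<^sub>i\<close>.  The sum of these over
  \<open>i \<le> m\<close> is nonnegative because \<open>b\<close> has all its mass there.
\<close>

lemma rel_entropy_bi_nonneg:
  assumes "0 < c" "c < 1" "0 < c'" "c' < 1" and "m \<le> m'"
  shows "0 \<le> rel_entropy (bi m c) (bi m' c')"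
proof -
  let ?b = "bi m c" and ?b' = "bi m' c'"
  have "?b i - ?b' i \<le> ?b i * ln (?b i / ?b' i)" if "i \<le> m" for i
  proof -
    have pos: "0 < ?b i" "0 < ?b' i" using that assms by (auto intro!: bi_pos)
    then have "ln (?b' i / ?b i) \<le> ?b' i / ?b i - 1"
      by (intro ln_le_minus_one) simp
    then have "?b i * ln (?b' i / ?b i) \<le> ?b i * (?b' i / ?b i - 1)"
      using pos by (intro mult_left_mono) auto
    then show ?thesis
      using pos by (simp add: ln_div algebra_simps)
  qed
  then have "(\<Sum>i\<le>m. ?b i) - (\<Sum>i\<le>m. ?b' i) \<le> (\<Sum>i\<le>m. ?b i * ln (?b i / ?b' i))"
    unfolding sum_subtractf[symmetric] by (intro sum_mono) auto
  moreover have "(\<Sum>i\<le>m. ?b i) = 1"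
    using assms by (intro sum_pmf_eq_1) auto
  moreover have "(\<Sum>i\<le>m. ?b' i) \<le> 1"
    by (simp add: measure_measure_pmf_finite[symmetric] del: pmf_binomial)
  ultimately show ?thesis
    using assms by (subst rel_entropy_eq_sum[where m = m]) (auto simp: bi_pos bi_eq_0 simp del: pmf_binomial)
qed

section \<open>The Pythagorean inequality\<close>

theorem theorem7:
  fixes M :: "'a measure"
    and X :: "nat \<Rightarrow> 'a \<Rightarrow> nat"
    and n m m' :: nat
    and p :: "nat \<Rightarrow> real"
    and p' lam pbar :: real
    and fS :: "nat \<Rightarrow> real"
  assumes "prob_space M"
    and "n \<ge> 1"
    and "prob_space.indep_vars M (\<lambda>_. count_space UNIV) X {1..n}"
    and "\<And>i. i \<in> {1..n} \<Longrightarrow> 0 < p i \<and> p i < 1"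
    and "\<And>i. i \<in> {1..n} \<Longrightarrow> \<P>(\<omega> in M. X i \<omega> = 1) = p i"
    and "\<And>i. i \<in> {1..n} \<Longrightarrow> \<P>(\<omega> in M. X i \<omega> = 0) = 1 - p i"
    and "\<And>k. fS k = \<P>(\<omega> in M. (\<Sum>i=1..n. X i \<omega>) = k)"
    and "lam = (\<Sum>i=1..n. p i)"
    and "pbar = lam / real n"
    and "m' \<ge> m" and "m \<ge> n"
    and "0 < p'" and "p' < 1"
  shows "rel_entropy fS (bi m' p') \<ge>
           rel_entropy fS (bi m (lam / real m)) + rel_entropy (bi m (lam / real m)) (bi m' p')
       \<and> rel_entropy fS (bi m' p') \<ge> rel_entropy fS (bi m (lam / real m))
       \<and> rel_entropy fS (bi m (lam / real m)) \<ge> rel_entropy fS (bi n pbar)"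
proof -
  define ps where "ps = map p (rev [1..<Suc n])"
  have fS: "fS = poisson_binomial ps"
    unfolding ps_def fun_eq_iff assms(7)
    using prob_space.prob_sum_bernoulli_eq_poisson_binomial[OF assms(1,3,5,6)] by blast
  have ps: "set ps \<subseteq> {0..1}" "length ps = n"
    using assms(4) by (auto simp: ps_def less_imp_le simp del: upt_Suc)
  have sum_ps: "sum_list ps = lam"
    unfolding ps_def assms(8)
    by (simp add: rev_map[symmetric] interv_sum_list_conv_sum_set_nat
        atLeastLessThanSuc_atLeastAtMost del: upt_Suc)
  have "0 < lam"
    unfolding assms(8) using assms(2,4) by (intro sum_pos) auto
  moreover have "lam < (\<Sum>i=1..n. 1)"
    unfolding assms(8) using assms(2,4) by (intro sum_strict_mono) auto
  ultimately have lam: "0 < lam / real k" "lam / real k < 1" if "k \<ge> n" for k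
    using that assms(2) by (auto simp: divide_simps)
  have pyth: "rel_entropy fS (bi k (lam / real k)) + rel_entropy (bi k (lam / real k)) (bi k' c)
      \<le> rel_entropy fS (bi k' c)"
    "rel_entropy fS (bi k (lam / real k)) \<le> rel_entropy fS (bi k' c)"
    if "n \<le> k" "k \<le> k'" "0 < c" "c < 1" for k k' c
  proof -
    show "rel_entropy fS (bi k (lam / real k)) + rel_entropy (bi k (lam / real k)) (bi k' c)
      \<le> rel_entropy fS (bi k' c)"
      unfolding fS using that ps sum_ps lam[OF that(1)] assms(2)
      by (intro rel_entropy_poisson_binomial_pythagoras) auto
    moreover have "0 \<le> rel_entropy (bi k (lam / real k)) (bi k' c)"
      using that lam[OF that(1)] by (intro rel_entropy_bi_nonneg)
    ultimately show "rel_entropy fS (bi k (lam / real k)) \<le> rel_entropy fS (bi k' c)"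
      by (meson add_increasing2 order_trans order_refl)
  qed
  have "rel_entropy fS (bi n pbar) \<le> rel_entropy fS (bi m (lam / real m))"
    unfolding assms(9) using assms(11) lam by (intro pyth(2)) auto
  then show ?thesis
    using pyth assms(10-13) by blast
qed

end
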